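(* Let $n$ and $r$ be positive integers such that $r<n$, and let $\mathcal{H}$ be a connected $r$-uniform hypergraph with $n$ vertices. Suppose that $\mathcal{H}$ has a spanning subhypergraph $\mathcal{H}_0$ which has an elimination ordering. Then $$hk(\mathcal{H}) = |E(\mathcal{H})|-|V(\mathcal{H})|+r.$$
   Context: A hypergraph $\mathcal{H}$ consists of a finite nonempty vertex set $V(\mathcal{H})$ and a set $E(\mathcal{H})$ of subsets of $V(\mathcal{H})$ called hyperedges. All hypergraphs may have isolated vertices (vertices in no hyperedge) but have no loops, so every hyperedge has at least two vertices. For a finite set $I$ disjoint from $V(\mathcal{H})$, $\mathcal{H}\cup I$ is the hypergraph with vertex set $V(\mathcal{H})\cup I$ and hyperedge set $E(\mathcal{H})$. For a digraph $D$ and a vertex $v$, the in-neighborhood is $N_D^-(v)=\{x : (x,v)\in A(D)\}$. The competition hypergraph $C\mathcal{H}(D)$ of $D$ is the hypergraph with vertex set $V(D)$ in which $e\subseteq V(D)$ is a hyperedge if and only if $|e|\ge 2$ and $e=N_D^-(v)$ for some vertex $v$ of $D$. The hypercompetition number $hk(\mathcal{H})$ is the smallest integer $k\ge 0$ such that $\mathcal{H}\cup I$, where $I$ is a set of $k$ new isolated vertices, is the competition hypergraph of some acyclic digraph (one with no directed cycles, in particular no loops). A hypergraph $\mathcal{H}$ is $r$-uniform, where $2\le r\le |V(\mathcal{H})|$, if every hyperedge has size $r$. A path in $\mathcal{H}$ is a sequence $v_0v_1\cdots v_k$ of distinct vertices for which there exist $k$ distinct hyperedges $e_1,\dots,e_k$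 with $\{v_{i-1},v_i\}\subseteq e_i$ for $1\le i\le k$; $\mathcal{H}$ is connected if there is a path between any two vertices. A spanning subhypergraph $\mathcal{H}_0$ of $\mathcal{H}$ satisfies $V(\mathcal{H}_0)=V(\mathcal{H})$ and $E(\mathcal{H}_0)\subseteq E(\mathcal{H})$. The degree of a vertex in a hypergraph is the number of hyperedges containing it. The subhypergraph of a hypergraph induced by a vertex set $S$ has vertex set $S$ and hyperedges exactly those hyperedges contained in $S$. An ordering $v_1,\dots,v_n$ of the vertices of an $r$-uniform hypergraph is an elimination ordering of it if, for each $r\le i\le n$, the vertex $v_i$ has degree one in the subhypergraph induced by $\{v_1,\dots,v_i\}$. *)

theory Defs
  imports "Graph_Theory.Pair_Digraph"
begin

record 'a hypergraph =
  hverts :: "'a set"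
  hedges :: "'a set set"

text \<open>There are no loops, so every hyperedge has at least two vertices; isolated vertices are allowed.\<close>

definition hypergraph :: "'a hypergraph \<Rightarrow> bool" where
  "hypergraph H \<longleftrightarrow> finite (hverts H) \<and> hverts H \<noteq> {} \<and>
     (\<forall>e\<in>hedges H. e \<subseteq> hverts H \<and> 2 \<le> card e)"

definition map_hypergraph :: "('a \<Rightarrow> 'b) \<Rightarrow> 'a hypergraph \<Rightarrow> 'b hypergraph" where
  "map_hypergraph f H = \<lparr> hverts = f ` hverts H, hedges = (\<lambda>e. f ` e) ` hedges H \<rparr>"

definition add_isolated :: "'a hypergraph \<Rightarrow> 'a set \<Rightarrow> 'a hypergraph" where
  "add_isolated H I = \<lparr> hverts = hverts H \<union> I, hedges = hedges H \<rparr>"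

definition in_neighborhood :: "'a pair_pre_digraph \<Rightarrow> 'a \<Rightarrow> 'a set" where
  "in_neighborhood D v = {x. (x, v) \<in> parcs D}"

definition competition_hypergraph :: "'a pair_pre_digraph \<Rightarrow> 'a hypergraph" where
  "competition_hypergraph D =
     \<lparr> hverts = pverts D,
       hedges = {e. e \<subseteq> pverts D \<and> 2 \<le> card e \<and> (\<exists>v\<in>pverts D. e = in_neighborhood D v)} \<rparr>"

text \<open>A loop is a cycle of length one for \<^const>\<open>pre_digraph.cycle\<close>, so it is excluded as well.\<close>

definition acyclic_digraph :: "'a pair_pre_digraph \<Rightarrow> bool" where
  "acyclic_digraph D \<longleftrightarrow> pair_fin_digraph D \<and> \<not> (\<exists>p. pre_digraph.cycle (with_proj D) p)"

text \<open>
  The vertex type may be finite, so \<open>H\<close> is first embedded along \<^const>\<open>Inl\<close> into a type that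
  always has enough fresh elements to serve as new isolated vertices.
\<close>

definition hypercompetition_number :: "'a hypergraph \<Rightarrow> nat" where
  "hypercompetition_number H =
     (LEAST k. \<exists>(I :: ('a + nat) set) D.
        finite I \<and> card I = k \<and> I \<inter> hverts (map_hypergraph Inl H) = {} \<and>
        acyclic_digraph D \<and>
        competition_hypergraph D = add_isolated (map_hypergraph Inl H) I)"

definition uniform :: "nat \<Rightarrow> 'a hypergraph \<Rightarrow> bool" where
  "uniform r H \<longleftrightarrow> 2 \<le> r \<and> r \<le> card (hverts H) \<and> (\<forall>e\<in>hedges H. card e = r)"

text \<open>\<open>vs\<close> is the sequence of distinct vertices, \<open>es\<close> a witnessing sequence of distinct hyperedges.\<close>

definition hpath :: "'a hypergraph \<Rightarrow> 'a list \<Rightarrow> bool" where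
  "hpath H vs \<longleftrightarrow> vs \<noteq> [] \<and> distinct vs \<and> set vs \<subseteq> hverts H \<and>
     (\<exists>es. distinct es \<and> set es \<subseteq> hedges H \<and> length vs = Suc (length es) \<and>
        (\<forall>i<length es. {vs ! i, vs ! Suc i} \<subseteq> es ! i))"

definition hconnected :: "'a hypergraph \<Rightarrow> bool" where
  "hconnected H \<longleftrightarrow>
     (\<forall>u\<in>hverts H. \<forall>v\<in>hverts H. \<exists>vs. hpath H vs \<and> hd vs = u \<and> last vs = v)"

definition spanning_subhypergraph :: "'a hypergraph \<Rightarrow> 'a hypergraph \<Rightarrow> bool" where
  "spanning_subhypergraph H0 H \<longleftrightarrow> hverts H0 = hverts H \<and> hedges H0 \<subseteq> hedges H"

definition hdegree :: "'a hypergraph \<Rightarrow> 'a \<Rightarrow> nat" where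
  "hdegree H v = card {e \<in> hedges H. v \<in> e}"

definition induced_subhypergraph :: "'a hypergraph \<Rightarrow> 'a set \<Rightarrow> 'a hypergraph" where
  "induced_subhypergraph H S = \<lparr> hverts = S, hedges = {e \<in> hedges H. e \<subseteq> S} \<rparr>"

text \<open>Lists are indexed from 0, so the \<open>i\<close>-th vertex of the ordering is \<open>vs ! (i - 1)\<close>.\<close>

definition elimination_ordering :: "nat \<Rightarrow> 'a hypergraph \<Rightarrow> 'a list \<Rightarrow> bool" where
  "elimination_ordering r H vs \<longleftrightarrow> distinct vs \<and> set vs = hverts H \<and>
     (\<forall>i. r \<le> i \<and> i \<le> length vs \<longrightarrow>
        hdegree (induced_subhypergraph H (set (take i vs))) (vs ! (i - 1)) = 1)"

end

theory Submission
  imports Defs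
begin

text \<open>
  In a competition hypergraph every hyperedge is the in-neighborhood of some vertex, its prey, and
  distinct hyperedges have distinct prey. The hypercompetition number therefore measures how many
  hyperedges cannot find their prey among the vertices of the hypergraph itself.

  Lower bound. In an acyclic digraph all in-neighbors of a vertex that is minimal among those
  of in-degree at least \<open>r\<close> have in-degree less than \<open>r\<close>, so at least \<open>r\<close> vertices are useless as prey
  for a hyperedge of size \<open>r\<close>. Hence \<open>|E| \<le> |V| + k - r\<close> whenever \<open>k\<close> isolated vertices suffice
  (\<open>card_hedges_competition_hypergraph\<close>).

  Upper bound. An elimination ordering \<open>v\<^sub>1, \<dots>, v\<^sub>n\<close> supplies for each \<open>r \<le> i < n\<close> a hyperedge
  \<open>e\<^sub>i \<subseteq> {v\<^sub>1, \<dots>, v\<^sub>i}\<close> that contains \<open>v\<^sub>i\<close>. These hyperedges are distinct, since \<open>v\<^sub>i\<close> is the last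
  vertex of \<open>e\<^sub>i\<close>, and \<open>v\<^sub>i\<^sub>+\<^sub>1\<close> can serve as the prey of \<open>e\<^sub>i\<close> with all arcs going forward in the
  ordering. The remaining \<open>|E| - (n - r)\<close> hyperedges each receive a new isolated vertex as prey,
  and the two bounds coincide.
\<close>

section \<open>Acyclicity and rank functions\<close>

text \<open>
  This replaces cycles as arc sequences by the transitive closure of the arc relation, so that
  well-founded minimality (for the lower bound) and rank functions (for the upper bound) apply.
\<close>

lemma acyclic_digraph_iff_acyclic_parcs:
  "acyclic_digraph D \<longleftrightarrow> pair_fin_digraph D \<and> acyclic (parcs D)"
proof (cases "pair_fin_digraph D")
  case True
  then interpret pair_fin_digraph D .
  have "(\<exists>p. cycle p) \<longleftrightarrow> (\<exists>p. closed_w p)"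
    using closed_w_imp_cycle cycle_altdef by blast
  also have "\<dots> \<longleftrightarrow> (\<exists>u. (u, u) \<in> (parcs D)\<^sup>+)"
    by (auto simp: closed_w_def reachable1_awalk)
  finally show ?thesis
    using True by (auto simp: acyclic_digraph_def acyclic_def)
qed (simp add: acyclic_digraph_def)

lemma acyclic_if_rank_less:
  fixes rk :: "'a \<Rightarrow> nat"
  assumes "\<And>x y. (x, y) \<in> R \<Longrightarrow> rk x < rk y"
  shows "acyclic R"
proof -
  have "R \<subseteq> measure rk"
    using assms by auto
  then show ?thesis
    by (meson wf_acyclic wf_measure wf_subset)
qed

section \<open>Competition hypergraphs through prey\<close>

text \<open>
  The digraph is read off from the prey assignment: every member of a hyperedge \<open>e\<close> sends an arc to
  \<open>p e\<close>. Injectivity of \<open>p\<close> keeps the in-neighborhood of \<open>p e\<close> from mixing several hyperedges.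
\<close>

lemma competition_hypergraph_if_prey:
  fixes rk :: "'a \<Rightarrow> nat"
  assumes H: "hypergraph H"
    and inj: "inj_on p (hedges H)"
    and prey: "p ` hedges H \<subseteq> hverts H"
    and rank: "\<And>e x. e \<in> hedges H \<Longrightarrow> x \<in> e \<Longrightarrow> rk x < rk (p e)"
  shows "\<exists>D. acyclic_digraph D \<and> competition_hypergraph D = H"
proof -
  define A where "A = {(x, p e) | x e. e \<in> hedges H \<and> x \<in> e}"
  define D where "D = \<lparr>pverts = hverts H, parcs = A\<rparr>"
  have fin: "finite (hverts H)" and edges: "\<And>e. e \<in> hedges H \<Longrightarrow> e \<subseteq> hverts H \<and> 2 \<le> card e"
    using H by (auto simp: hypergraph_def)
  have A_sub: "A \<subseteq> hverts H \<times> hverts H"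
    using edges prey by (fastforce simp: A_def)
  have "pair_fin_digraph D"
    by unfold_locales (use A_sub fin in \<open>auto simp: D_def intro: finite_subset\<close>)
  moreover have "acyclic (parcs D)"
    by (rule acyclic_if_rank_less[of _ rk]) (auto simp: D_def A_def rank)
  ultimately have "acyclic_digraph D"
    by (simp add: acyclic_digraph_iff_acyclic_parcs)
  moreover have "competition_hypergraph D = H"
  proof -
    have nbh: "in_neighborhood D (p e) = e" if "e \<in> hedges H" for e
      using that inj by (auto simp: in_neighborhood_def D_def A_def dest: inj_onD)
    have no_prey: "in_neighborhood D v = {}" if "v \<notin> p ` hedges H" for v
      using that by (auto simp: in_neighborhood_def D_def A_def)
    have "e \<in> hedges H \<longleftrightarrow>
      e \<subseteq> hverts H \<and> 2 \<le> card e \<and> (\<exists>v\<in>hverts H. e = in_neighborhood D v)" (is "_ \<longleftrightarrow> ?R") for e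
    proof
      assume "e \<in> hedges H"
      then show ?R
        using edges prey nbh by blast
    next
      assume ?R
      then obtain v where v: "e = in_neighborhood D v" "2 \<le> card e" by blast
      then have "v \<in> p ` hedges H"
        using no_prey by force
      then show "e \<in> hedges H"
        using v nbh by auto
    qed
    then have "hedges (competition_hypergraph D) = hedges H"
      by (auto simp: competition_hypergraph_def D_def)
    then show ?thesis
      by (simp add: competition_hypergraph_def D_def)
  qed
  ultimately show ?thesis by blast
qed

text \<open>
  A minimal vertex among those of in-degree at least \<open>r\<close> has all its (at least \<open>r\<close>) in-neighbors
  outside that set.
\<close>

lemma card_large_in_neighborhoods:
  assumes D: "acyclic_digraph D" and r: "r \<le> card (pverts D)"
  shows "card {v \<in> pverts D. r \<le> card (in_neighborhood D v)} + r \<le> card (pverts D)"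
    (is "card ?S + r \<le> _")
proof (cases "?S = {}")
  case True
  then show ?thesis using r by (simp only: card.empty)
next
  case False
  interpret pair_fin_digraph D
    using D by (simp add: acyclic_digraph_iff_acyclic_parcs)
  have "wf (parcs D)"
    using D by (simp add: acyclic_digraph_iff_acyclic_parcs finite_acyclic_wf pair_finite_arcs)
  then obtain v where v: "v \<in> ?S" and min: "\<And>u. (u, v) \<in> parcs D \<Longrightarrow> u \<notin> ?S"
    using False by (rule wfE_min') blast
  have "in_neighborhood D v \<subseteq> pverts D - ?S"
    using min in_arcsD1 unfolding in_neighborhood_def by blast
  then have "card (in_neighborhood D v) \<le> card (pverts D - ?S)"
    using pair_finite_verts by (intro card_mono) auto
  also have "\<dots> = card (pverts D) - card ?S"
    using pair_finite_verts by (intro card_Diff_subset) auto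
  finally have "r \<le> card (pverts D) - card ?S"
    using v by simp
  moreover have "card ?S \<le> card (pverts D)"
    using pair_finite_verts by (intro card_mono) auto
  ultimately show ?thesis by linarith
qed

lemma card_hedges_competition_hypergraph:
  assumes D: "acyclic_digraph D"
    and r: "r \<le> card (hverts (competition_hypergraph D))"
    and size: "\<And>e. e \<in> hedges (competition_hypergraph D) \<Longrightarrow> r \<le> card e"
  shows "card (hedges (competition_hypergraph D)) + r \<le> card (hverts (competition_hypergraph D))"
proof -
  let ?S = "{v \<in> pverts D. r \<le> card (in_neighborhood D v)}"
  have "finite ?S"
    using D by (simp add: acyclic_digraph_def pair_fin_digraph.pair_finite_verts)
  moreover have "hedges (competition_hypergraph D) \<subseteq> in_neighborhood D ` ?S"
    using size by (auto simp: competition_hypergraph_def)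
  ultimately have "card (hedges (competition_hypergraph D)) \<le> card ?S"
    by (rule surj_card_le)
  moreover have "card ?S + r \<le> card (pverts D)"
    using card_large_in_neighborhoods[OF D] r by (simp add: competition_hypergraph_def)
  ultimately show ?thesis
    by (simp add: competition_hypergraph_def)
qed

section \<open>Elimination orderings\<close>

text \<open>
  The vertex \<open>vs ! (i - 1)\<close> has positive degree among the first \<open>i\<close> vertices, which gives \<open>f i\<close>; it is
  the last vertex of \<open>f i\<close>, which makes \<open>f\<close> injective. Positions are counted from \<open>0\<close>, so \<open>vs ! i\<close> is
  the first vertex after those in \<open>f i\<close>.
\<close>

lemma elimination_ordering_edges:
  assumes vs: "elimination_ordering r H vs" and r: "0 < r"
  obtains f where "f ` {r..length vs} \<subseteq> hedges H" "inj_on f {r..length vs}"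
    "\<And>i. i \<in> {r..length vs} \<Longrightarrow> f i \<subseteq> set (take i vs)"
proof -
  have dist: "distinct vs"
    using vs by (simp add: elimination_ordering_def)
  have "\<exists>e. e \<in> hedges H \<and> e \<subseteq> set (take i vs) \<and> vs ! (i - 1) \<in> e" if "i \<in> {r..length vs}" for i
  proof -
    have "hdegree (induced_subhypergraph H (set (take i vs))) (vs ! (i - 1)) \<noteq> 0"
      using vs that by (simp add: elimination_ordering_def)
    then have "{e \<in> {e \<in> hedges H. e \<subseteq> set (take i vs)}. vs ! (i - 1) \<in> e} \<noteq> {}"
      unfolding hdegree_def induced_subhypergraph_def by (metis card.empty hypergraph.select_convs(2))
    then show ?thesis by blast
  qed
  then obtain f where f: "\<And>i. i \<in> {r..length vs} \<Longrightarrow>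
      f i \<in> hedges H \<and> f i \<subseteq> set (take i vs) \<and> vs ! (i - 1) \<in> f i"
    by metis
  have "f i \<noteq> f j" if "i \<in> {r..length vs}" "j \<in> {r..length vs}" "i < j" for i j
  proof
    assume "f i = f j"
    then have "vs ! (j - 1) \<in> set (take i vs)"
      using f that by blast
    then obtain m where "m < i" "vs ! m = vs ! (j - 1)"
      using that by (auto simp: in_set_conv_nth)
    moreover have "m \<noteq> j - 1" "m < length vs" "j - 1 < length vs"
      using \<open>m < i\<close> that by auto
    ultimately show False
      using dist by (simp add: nth_eq_iff_index_eq)
  qed
  then have "inj_on f {r..length vs}"
    by (metis inj_onI linorder_neqE_nat)
  then show thesis
    using that f by blast
qed

section \<open>The hypercompetition number\<close>

text \<open>
  The hypercompetition number is the least \<open>k\<close> with this property; naming it separates membership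
  and minimality into two independent lemmas.
\<close>

definition competes_with_isolated :: "'a hypergraph \<Rightarrow> nat \<Rightarrow> bool" where
  "competes_with_isolated H k \<longleftrightarrow> (\<exists>(I :: ('a + nat) set) D.
     finite I \<and> card I = k \<and> I \<inter> hverts (map_hypergraph Inl H) = {} \<and>
     acyclic_digraph D \<and> competition_hypergraph D = add_isolated (map_hypergraph Inl H) I)"

lemma hypercompetition_number_eq_Least:
  "hypercompetition_number H = (LEAST k. competes_with_isolated H k)"
  by (simp add: hypercompetition_number_def competes_with_isolated_def)

lemma inj_image_Inl: "inj ((`) Inl)"
  by (simp add: inj_on_image)

lemma card_hedges_le_if_competes:
  assumes H: "hypergraph H" "uniform r H" and k: "competes_with_isolated H k"
  shows "card (hedges H) + r \<le> card (hverts H) + k"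
proof -
  obtain I :: "('a + nat) set" and D where I: "finite I" "card I = k" "I \<inter> Inl ` hverts H = {}"
    and D: "acyclic_digraph D" and CD: "competition_hypergraph D = add_isolated (map_hypergraph Inl H) I"
    using k by (auto simp: competes_with_isolated_def map_hypergraph_def)
  have "card (hverts (competition_hypergraph D)) = card (Inl ` hverts H :: ('a + nat) set) + card I"
    unfolding CD using I H
    by (auto simp: add_isolated_def map_hypergraph_def hypergraph_def Int_commute intro!: card_Un_disjoint)
  then have verts: "card (hverts (competition_hypergraph D)) = card (hverts H) + k"
    using I by (simp add: card_image)
  have "card (hedges (competition_hypergraph D)) = card (hedges H)"
    unfolding CD by (simp add: add_isolated_def map_hypergraph_def card_image inj_on_subset[OF inj_image_Inl])
  moreover have "card (hedges (competition_hypergraph D)) + r \<le> card (hverts (competition_hypergraph D))"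
  proof (rule card_hedges_competition_hypergraph[OF D])
    show "r \<le> card (hverts (competition_hypergraph D))"
      using verts H by (simp add: uniform_def)
    show "r \<le> card e" if "e \<in> hedges (competition_hypergraph D)" for e
      using that H unfolding CD
      by (auto simp: add_isolated_def map_hypergraph_def uniform_def card_image)
  qed
  ultimately show ?thesis
    using verts by simp
qed

text \<open>
  The ranks of the vertices are their positions in \<open>vs\<close>; every new isolated vertex is ranked last.
\<close>

lemma competes_if_edges_along_ordering:
  assumes H: "hypergraph H" and vs: "distinct vs" "set vs = hverts H"
    and f: "f ` {r..<length vs} \<subseteq> hedges H" "inj_on f {r..<length vs}"
    and before: "\<And>i. i \<in> {r..<length vs} \<Longrightarrow> f i \<subseteq> set (take i vs)"
  shows "competes_with_isolated H (card (hedges H) - (length vs - r))"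
proof -
  define F where "F = f ` {r..<length vs}"
  define k where "k = card (hedges H) - (length vs - r)"
  define K where "K = add_isolated (map_hypergraph Inl H) (Inr ` {..<k} :: ('a + nat) set)"
  have edges: "\<And>e. e \<in> hedges H \<Longrightarrow> e \<subseteq> hverts H \<and> 2 \<le> card e" and fin: "finite (hverts H)"
    using H by (auto simp: hypergraph_def)
  have finE: "finite (hedges H)"
    using edges fin by (meson Pow_iff finite_Pow_iff finite_subset subsetI)
  have "card (hedges H - F) = k"
    using f finE by (simp add: F_def k_def card_Diff_subset card_image)
  moreover have "finite (hedges H - F)"
    using finE by simp
  ultimately obtain h where h: "bij_betw h (hedges H - F) {..<k}"
    using ex_bij_betw_finite_nat lessThan_atLeast0 by metis
  define q where "q = the_inv_into {r..<length vs} f"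
  have q: "q e \<in> {r..<length vs}" "f (q e) = e" if "e \<in> F" for e
    using that the_inv_into_into[OF f(2) _ subset_refl] f_the_inv_into_f[OF f(2)]
    unfolding F_def q_def by blast+
  define p :: "'a set \<Rightarrow> 'a + nat" where
    "p e = (if e \<in> F then Inl (vs ! q e) else Inr (h e))" for e
  define idx where "idx = the_inv_into {..<length vs} ((!) vs)"
  have inj_nth: "inj_on ((!) vs) {..<length vs}"
    using vs by (simp add: inj_on_nth)
  have idx: "idx (vs ! i) = i" if "i < length vs" for i
    using that the_inv_into_f_f[OF inj_nth] by (simp add: idx_def)
  define rk :: "'a + nat \<Rightarrow> nat" where "rk = case_sum idx (\<lambda>_. length vs)"
  have p_inj: "inj_on p (hedges H)"
  proof (rule inj_onI)
    fix d e assume d: "d \<in> hedges H" and e: "e \<in> hedges H" and eq: "p d = p e"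
    show "d = e"
    proof (cases "d \<in> F")
      case True
      then have "e \<in> F" "vs ! q d = vs ! q e"
        using eq by (auto simp: p_def split: if_splits)
      then have "q d = q e"
        using True q idx by (metis atLeastLessThan_iff)
      then show ?thesis
        using True \<open>e \<in> F\<close> q by metis
    next
      case False
      then have "e \<notin> F" "h d = h e"
        using eq by (auto simp: p_def split: if_splits)
      then show ?thesis
        using False d e h by (auto simp: bij_betw_def dest: inj_onD)
    qed
  qed
  have p_verts: "p e \<in> hverts K" if "e \<in> hedges H" for e
  proof (cases "e \<in> F")
    case True
    then have "vs ! q e \<in> hverts H"
      using q[OF True] vs(2) by (metis atLeastLessThan_iff nth_mem)
    then show ?thesis
      using True by (simp add: p_def K_def add_isolated_def map_hypergraph_def)
  next
    case False
    then show ?thesis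
      using that bij_betwE[OF h] by (auto simp: p_def K_def add_isolated_def map_hypergraph_def)
  qed
  have p_rank: "rk (Inl x) < rk (p e)" if e: "e \<in> hedges H" and x: "x \<in> e" for e x
  proof (cases "e \<in> F")
    case True
    then have "x \<in> set (take (q e) vs)"
      using before[OF q(1)] q(2) x by blast
    then obtain m where "m < q e" "vs ! m = x"
      using q(1)[OF True] by (auto simp: in_set_conv_nth)
    then show ?thesis
      using True q(1)[OF True] idx by (auto simp: rk_def p_def)
  next
    case False
    have "x \<in> set vs"
      using e x edges vs(2) by blast
    then show ?thesis
      using False idx by (auto simp: rk_def p_def in_set_conv_nth)
  qed
  have hedges_K: "hedges K = (`) Inl ` hedges H"
    by (simp add: K_def add_isolated_def map_hypergraph_def)
  have vimage: "Inl -` (Inl ` e :: ('a + nat) set) = e" for e :: "'a set"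
    by auto
  have "hypergraph K"
    using H unfolding hypergraph_def K_def add_isolated_def map_hypergraph_def
    by (fastforce simp: card_image)
  moreover have "inj_on (\<lambda>e. p (Inl -` e)) (hedges K)"
    unfolding hedges_K using p_inj by (auto simp: inj_on_def vimage)
  moreover have "(\<lambda>e. p (Inl -` e)) ` hedges K \<subseteq> hverts K"
    unfolding hedges_K using p_verts by (auto simp: vimage)
  moreover have "rk x < rk (p (Inl -` e))" if "e \<in> hedges K" "x \<in> e" for e x
    using that p_rank unfolding hedges_K by (auto simp: vimage)
  ultimately have "\<exists>D. acyclic_digraph D \<and> competition_hypergraph D = K"
    by (rule competition_hypergraph_if_prey)
  moreover have "Inr ` {..<k} \<inter> hverts (map_hypergraph Inl H) = {}"
    by (auto simp: map_hypergraph_def)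
  moreover have "card (Inr ` {..<k} :: ('a + nat) set) = k"
    by (simp add: card_image)
  ultimately show ?thesis
    unfolding competes_with_isolated_def k_def[symmetric] K_def by blast
qed

theorem theorem2p5:
  fixes n r :: nat and H :: "'a hypergraph"
  assumes "0 < n" and "0 < r" and "r < n"
    and "hypergraph H" and "uniform r H" and "hconnected H"
    and "card (hverts H) = n"
    and "\<exists>H0. spanning_subhypergraph H0 H \<and> (\<exists>vs. elimination_ordering r H0 vs)"
  shows "int (hypercompetition_number H) =
           int (card (hedges H)) - int (card (hverts H)) + int r"
proof -
  obtain H0 vs where H0: "spanning_subhypergraph H0 H" and elim: "elimination_ordering r H0 vs"
    using assms(8) by blast
  have vs: "distinct vs" "set vs = hverts H"
    using H0 elim by (auto simp: spanning_subhypergraph_def elimination_ordering_def)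
  then have len: "length vs = n"
    using assms(7) distinct_card by metis
  obtain f where f: "f ` {r..length vs} \<subseteq> hedges H0" "inj_on f {r..length vs}"
    "\<And>i. i \<in> {r..length vs} \<Longrightarrow> f i \<subseteq> set (take i vs)"
    using elimination_ordering_edges[OF elim assms(2)] by blast
  \<comment> \<open>The hyperedge ending in the last vertex is dropped: no vertex of \<open>H\<close> follows as its prey.\<close>
  have f': "f ` {r..<length vs} \<subseteq> hedges H" "inj_on f {r..<length vs}"
  proof -
    have "{r..<length vs} \<subseteq> {r..length vs}" by auto
    then show "f ` {r..<length vs} \<subseteq> hedges H" "inj_on f {r..<length vs}"
      using f(1,2) H0 unfolding spanning_subhypergraph_def by (blast intro: inj_on_subset)+
  qed
  have "finite (hedges H)"
    using assms(4) unfolding hypergraph_def by (meson Pow_iff finite_Pow_iff finite_subset subsetI)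
  \<comment> \<open>Subtraction on natural numbers does not truncate here.\<close>
  then have le: "n - r \<le> card (hedges H)"
    using card_inj_on_le[OF f'(2,1)] by (simp add: len)
  have "hypercompetition_number H = card (hedges H) - (n - r)"
    unfolding hypercompetition_number_eq_Least
  proof (rule Least_equality)
    show "competes_with_isolated H (card (hedges H) - (n - r))"
      using competes_if_edges_along_ordering[OF assms(4) vs f'] f(3) by (simp add: len)
    show "card (hedges H) - (n - r) \<le> k" if "competes_with_isolated H k" for k
      using card_hedges_le_if_competes[OF assms(4,5) that] assms(3,7) by linarith
  qed
  then show ?thesis
    using le assms(3,7) by linarith
qed

end
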